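(* Let $(K,v)$ be a valued field with value group $\Gamma_v$, and let $\Lambda$ be a totally ordered abelian group containing the divisible hull $\Gamma_{\mathbb{Q}}=\Gamma_v\otimes_{\mathbb{Z}}\mathbb{Q}$. Assume that $\Lambda$ is densely ordered. Then the Scott topology $\mathfrak{S}$ on $(\mathcal{T}(v,\Lambda),\leq)$ is strictly coarser than the weak tree topology $\mathfrak{W}$ on $\mathcal{T}(v,\Lambda)$.
   Context: A valuation on $K[x]$ is a map $\nu:K[x]\to\Lambda_\infty=\Lambda\cup\{\infty\}$ with $\nu(fg)=\nu(f)+\nu(g)$, $\nu(f+g)\geq\min\{\nu(f),\nu(g)\}$, $\nu(1)=0$, $\nu(0)=\infty$ (nonzero polynomials may have value $\infty$). $\Lambda$ is densely ordered if for all $\gamma<\lambda$ in $\Lambda$ there is $\alpha\in\Lambda$ with $\gamma<\alpha<\lambda$. $\mathcal{T}=\mathcal{T}(v,\Lambda)$ is the set of valuations $\nu:K[x]\to\Lambda_\infty$ with $\nu|_K=v$, partially ordered by $\mu\leq\nu$ iff $\mu(f)\leq\nu(f)$ for all $f\in K[x]$. Known facts: each $(-\infty,\mu]=\{\nu\in\mathcal{T}\mid\nu\leq\mu\}$ is totally ordered, and any $\mu,\nu\in\mathcal{T}$ have an infimum $\mu\wedge\nu\in\mathcal{T}$. Interval: $[\mu,\nu]=\{\eta\in\mathcal{T}\mid\mu\wedge\nu\leq\eta\leq\mu\text{ or }\mu\wedge\nu\leq\eta\leq\nu\}$. For $\mu\in\mathcal{T}$, on $\mathcal{T}\setminus\{\mu\}$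 let $\nu\sim_\mu\eta$ iff $\mu\notin[\nu,\eta]$ (an equivalence relation), with classes $[\nu]_\mu$. The weak tree topology $\mathfrak{W}$ is the topology on $\mathcal{T}$ generated by all sets $[\nu]_\mu$, $\mu\in\mathcal{T}$, $\nu\in\mathcal{T}\setminus\{\mu\}$. Scott topology of a partially ordered set $(P,\leq)$: a directed set is a non-empty $D\subseteq P$ in which every pair of elements has an upper bound in $D$. $O\subseteq P$ is Scott open if it is an upper set, and for every directed set $D\subseteq P$ having a supremum (least upper bound) lying in $O$ one has $D\cap O\neq\emptyset$. The Scott topology is the set of all Scott open sets. *)

theory Defs
  imports "HOL-Analysis.Analysis" "HOL-Computational_Algebra.Polynomial"
begin

subsection \<open>Adjoining infinity to an ordered abelian group\<close>

datatype 'a infty_ext = Fin 'a | PInf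

instantiation infty_ext :: (type) infinity
begin
definition infinity_infty_ext :: "'a infty_ext" where "\<infinity> = PInf"
instance ..
end

instantiation infty_ext :: (linorder) linorder
begin

definition less_eq_infty_ext :: "'a infty_ext \<Rightarrow> 'a infty_ext \<Rightarrow> bool" where
  "x \<le> y \<longleftrightarrow> (case y of PInf \<Rightarrow> True | Fin b \<Rightarrow> (case x of PInf \<Rightarrow> False | Fin a \<Rightarrow> a \<le> b))"

definition less_infty_ext :: "'a infty_ext \<Rightarrow> 'a infty_ext \<Rightarrow> bool" where
  "x < y \<longleftrightarrow> (case x of PInf \<Rightarrow> False | Fin a \<Rightarrow> (case y of PInf \<Rightarrow> True | Fin b \<Rightarrow> a < b))"

instance
  by standard (auto simp: less_eq_infty_ext_def less_infty_ext_def split: infty_ext.splits)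

end

instantiation infty_ext :: (comm_monoid_add) comm_monoid_add
begin

definition zero_infty_ext :: "'a infty_ext" where "0 = Fin 0"

definition plus_infty_ext :: "'a infty_ext \<Rightarrow> 'a infty_ext \<Rightarrow> 'a infty_ext" where
  "x + y = (case x of PInf \<Rightarrow> PInf | Fin a \<Rightarrow> (case y of PInf \<Rightarrow> PInf | Fin b \<Rightarrow> Fin (a + b)))"

instance
  by standard (auto simp: zero_infty_ext_def plus_infty_ext_def add_ac split: infty_ext.splits)

end

instance infty_ext :: (linordered_ab_group_add) ordered_comm_monoid_add
  by standard (auto simp: less_eq_infty_ext_def plus_infty_ext_def split: infty_ext.splits)


subsection \<open>Valuations\<close>

text \<open>
  Nonzero elements may have value \<open>\<infinity>\<close>. On a field this cannot happen, since
  \<open>\<nu> a + \<nu> (inverse a) = 0\<close> for \<open>a \<noteq> 0\<close>, so the same predicate describes valued fields.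
\<close>

definition is_valuation ::
    "('r :: comm_ring_1 \<Rightarrow> 'l :: linordered_ab_group_add infty_ext) \<Rightarrow> bool" where
  "is_valuation \<nu> \<longleftrightarrow>
     (\<forall>f g. \<nu> (f * g) = \<nu> f + \<nu> g) \<and>
     (\<forall>f g. \<nu> (f + g) \<ge> min (\<nu> f) (\<nu> g)) \<and>
     \<nu> 1 = 0 \<and> \<nu> 0 = \<infinity>"

definition value_group ::
    "('k :: field \<Rightarrow> 'l :: linordered_ab_group_add infty_ext) \<Rightarrow> 'l set" where
  "value_group v = {\<gamma>. \<exists>a. a \<noteq> 0 \<and> v a = Fin \<gamma>}"

text \<open>
  The divisible hull of \<open>G\<close> realised inside the ambient ordered group: a divisible subgroup
  containing \<open>G\<close> and torsion modulo \<open>G\<close>. As the ambient group is torsion-free, such an \<open>H\<close> is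
  canonically isomorphic to the tensor product of \<open>G\<close> with the rationals.
  The sum over \<open>{..<n}\<close> is the \<open>n\<close>-fold multiple.
\<close>

definition is_divisible_hull :: "'l :: linordered_ab_group_add set \<Rightarrow> 'l set \<Rightarrow> bool" where
  "is_divisible_hull G H \<longleftrightarrow>
     G \<subseteq> H \<and>
     0 \<in> H \<and> (\<forall>a\<in>H. \<forall>b\<in>H. a - b \<in> H) \<and>
     (\<forall>h\<in>H. \<forall>n::nat. n > 0 \<longrightarrow> (\<exists>h'\<in>H. (\<Sum>_<n. h') = h)) \<and>
     (\<forall>h\<in>H. \<exists>n::nat. n > 0 \<and> (\<Sum>_<n. h) \<in> G)"

text \<open>The partial order on this set is the pointwise order of functions.\<close>

definition valuation_tree ::
    "('k :: field \<Rightarrow> 'l :: linordered_ab_group_add infty_ext) \<Rightarrow> ('k poly \<Rightarrow> 'l infty_ext) set" where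
  "valuation_tree v = {\<nu>. is_valuation \<nu> \<and> (\<forall>a. \<nu> [:a:] = v a)}"


subsection \<open>The weak tree topology\<close>

text \<open>The infimum is taken within the poset \<open>P\<close>; it is meaningful only if it exists.\<close>

definition meet_in :: "'b :: order set \<Rightarrow> 'b \<Rightarrow> 'b \<Rightarrow> 'b" where
  "meet_in P \<mu> \<nu> = (GREATEST \<rho>. \<rho> \<in> P \<and> \<rho> \<le> \<mu> \<and> \<rho> \<le> \<nu>)"

definition tree_interval :: "'b :: order set \<Rightarrow> 'b \<Rightarrow> 'b \<Rightarrow> 'b set" where
  "tree_interval P \<mu> \<nu> =
     {\<eta> \<in> P. (meet_in P \<mu> \<nu> \<le> \<eta> \<and> \<eta> \<le> \<mu>) \<or> (meet_in P \<mu> \<nu> \<le> \<eta> \<and> \<eta> \<le> \<nu>)}"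

definition tree_rel :: "'b :: order set \<Rightarrow> 'b \<Rightarrow> ('b \<times> 'b) set" where
  "tree_rel P \<mu> = {(\<nu>, \<eta>). \<nu> \<in> P - {\<mu>} \<and> \<eta> \<in> P - {\<mu>} \<and> \<mu> \<notin> tree_interval P \<nu> \<eta>}"

text \<open>
  \<open>P\<close> is added to the subbasis because the carrier of \<open>topology_generated_by\<close> is the union of
  the generating sets.
\<close>

definition weak_tree_topology :: "'b :: order set \<Rightarrow> 'b topology" where
  "weak_tree_topology P =
     topology_generated_by (insert P (\<Union>\<mu>\<in>P. (P - {\<mu>}) // tree_rel P \<mu>))"


subsection \<open>The Scott topology\<close>

definition directed_in :: "'b :: order set \<Rightarrow> 'b set \<Rightarrow> bool" where
  "directed_in P D \<longleftrightarrow> D \<subseteq> P \<and> D \<noteq> {} \<and> (\<forall>a\<in>D. \<forall>b\<in>D. \<exists>c\<in>D. a \<le> c \<and> b \<le> c)"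

definition is_sup_in :: "'b :: order set \<Rightarrow> 'b set \<Rightarrow> 'b \<Rightarrow> bool" where
  "is_sup_in P D s \<longleftrightarrow>
     s \<in> P \<and> (\<forall>d\<in>D. d \<le> s) \<and> (\<forall>u\<in>P. (\<forall>d\<in>D. d \<le> u) \<longrightarrow> s \<le> u)"

definition scott_open :: "'b :: order set \<Rightarrow> 'b set \<Rightarrow> bool" where
  "scott_open P U \<longleftrightarrow>
     U \<subseteq> P \<and> (\<forall>x\<in>U. \<forall>y\<in>P. x \<le> y \<longrightarrow> y \<in> U) \<and>
     (\<forall>D s. directed_in P D \<longrightarrow> is_sup_in P D s \<longrightarrow> s \<in> U \<longrightarrow> D \<inter> U \<noteq> {})"

definition scott_topology :: "'b :: order set \<Rightarrow> 'b topology" where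
  "scott_topology P = topology (scott_open P)"

lemma scott_openI:
  assumes "U \<subseteq> P"
    and "\<And>x y. x \<in> U \<Longrightarrow> y \<in> P \<Longrightarrow> x \<le> y \<Longrightarrow> y \<in> U"
    and "\<And>D s. directed_in P D \<Longrightarrow> is_sup_in P D s \<Longrightarrow> s \<in> U \<Longrightarrow> D \<inter> U \<noteq> {}"
  shows "scott_open P U"
  unfolding scott_open_def
  by (intro conjI ballI allI impI; (rule assms; assumption))

lemma scott_open_subset: "scott_open P U \<Longrightarrow> U \<subseteq> P"
  unfolding scott_open_def by (elim conjE)

lemma scott_open_upper:
  assumes "scott_open P U" "x \<in> U" "y \<in> P" "x \<le> y"
  shows "y \<in> U"
proof -
  have "\<forall>x\<in>U. \<forall>y\<in>P. x \<le> y \<longrightarrow> y \<in> U"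
    using assms(1) unfolding scott_open_def by (elim conjE)
  from this[rule_format, OF assms(2-4)] show ?thesis .
qed

lemma scott_open_meets:
  assumes "scott_open P U" "directed_in P D" "is_sup_in P D s" "s \<in> U"
  obtains d where "d \<in> D" "d \<in> U"
proof -
  have "\<forall>D s. directed_in P D \<longrightarrow> is_sup_in P D s \<longrightarrow> s \<in> U \<longrightarrow> D \<inter> U \<noteq> {}"
    using assms(1) unfolding scott_open_def by (elim conjE)
  from this[rule_format, OF assms(2-4)] that show thesis by auto
qed

lemma istopology_scott_open: "istopology (scott_open P)"
  unfolding istopology_def
proof (intro conjI allI impI)
  fix U V assume U: "scott_open P U" and V: "scott_open P V"
  show "scott_open P (U \<inter> V)"
  proof (rule scott_openI)
    show "U \<inter> V \<subseteq> P" using scott_open_subset[OF U] by (rule le_infI1)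
    show "y \<in> U \<inter> V" if "x \<in> U \<inter> V" "y \<in> P" "x \<le> y" for x y
      using scott_open_upper[OF U _ that(2,3)] scott_open_upper[OF V _ that(2,3)] that(1) by simp
    show "D \<inter> (U \<inter> V) \<noteq> {}"
      if D: "directed_in P D" and s: "is_sup_in P D s" "s \<in> U \<inter> V" for D s
    proof -
      from s(2) have sU: "s \<in> U" and sV: "s \<in> V" by simp_all
      obtain a where a: "a \<in> D" "a \<in> U" by (rule scott_open_meets[OF U D s(1) sU])
      obtain b where b: "b \<in> D" "b \<in> V" by (rule scott_open_meets[OF V D s(1) sV])
      have DP: "D \<subseteq> P" and "\<forall>a\<in>D. \<forall>b\<in>D. \<exists>c\<in>D. a \<le> c \<and> b \<le> c"
        using D unfolding directed_in_def by simp_all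
      from this(2)[rule_format, OF a(1) b(1)] obtain c where c: "c \<in> D" "a \<le> c" "b \<le> c"
        by (elim bexE conjE)
      have "c \<in> P" using DP c(1) by (rule subsetD)
      then have "c \<in> U" "c \<in> V"
        using scott_open_upper[OF U a(2) _ c(2)] scott_open_upper[OF V b(2) _ c(3)] by simp_all
      then show ?thesis using c(1) by auto
    qed
  qed
next
  fix \<U> assume *: "\<forall>U\<in>\<U>. scott_open P U"
  show "scott_open P (\<Union>\<U>)"
  proof (rule scott_openI)
    show "\<Union>\<U> \<subseteq> P" by (rule Union_least, rule scott_open_subset, rule bspec[OF *])
    show "y \<in> \<Union>\<U>" if x: "x \<in> \<Union>\<U>" and y: "y \<in> P" "x \<le> y" for x y
    proof -
      obtain U where U: "U \<in> \<U>" "x \<in> U" by (rule UnionE[OF x])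
      have "y \<in> U" using scott_open_upper[OF bspec[OF * U(1)] U(2) y] .
      with U(1) show ?thesis by auto
    qed
    show "D \<inter> \<Union>\<U> \<noteq> {}"
      if D: "directed_in P D" and s: "is_sup_in P D s" "s \<in> \<Union>\<U>" for D s
    proof -
      obtain U where U: "U \<in> \<U>" "s \<in> U" by (rule UnionE[OF s(2)])
      obtain d where "d \<in> D" "d \<in> U"
        by (rule scott_open_meets[OF bspec[OF * U(1)] D s(1) U(2)])
      then show ?thesis using U(1) by auto
    qed
  qed
qed

lemma openin_scott_topology: "openin (scott_topology P) = scott_open P"
  unfolding scott_topology_def by (rule topology_inverse'[OF istopology_scott_open])


subsection \<open>Comparing topologies\<close>

definition strictly_coarser :: "'b topology \<Rightarrow> 'b topology \<Rightarrow> bool" where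
  "strictly_coarser S W \<longleftrightarrow>
     topspace S = topspace W \<and> {U. openin S U} \<subset> {U. openin W U}"

end

theory Submission imports Defs begin

text \<open>
  The comparison is pure order theory once principal ideals are chains and binary meets exist.
  For \<open>\<rho> < \<eta>\<close> the class of \<open>\<eta>\<close> relative to \<open>\<rho>\<close> lies above \<open>\<rho>\<close>. If \<open>\<eta>\<close> is the supremum of its
  strict lower bounds, a Scott open set around \<open>\<eta>\<close> contains such a \<open>\<rho>\<close>; otherwise \<open>\<eta>\<close> has an
  immediate predecessor, relative to which its class is the principal filter of \<open>\<eta>\<close>. If there is no
  strict lower bound at all, \<open>\<eta>\<close> is the least element. Classes of \<open>\<nu>\<close> relative to some \<open>\<mu> > \<nu>\<close> are
  not upper sets, so the inclusion is strict.

  Both order properties of valuations come from a polynomial \<open>\<phi>\<close> of least degree at which \<open>\<mu>\<close> and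
  \<open>\<nu>\<close> differ, say with \<open>\<mu> \<phi> < \<nu> \<phi>\<close>: the meet is the augmented valuation sending a \<open>\<phi>\<close>-adic
  expansion to the least value \<open>\<mu> f\<^sub>i + i \<mu> \<phi>\<close> of its terms, and it equals \<open>\<mu>\<close> when \<open>\<mu> \<le> \<nu>\<close>.
\<close>

section \<open>Topologies on posets with meets whose principal ideals are chains\<close>

lemma meet_in_eqI:
  assumes "\<rho> \<in> P" "\<rho> \<le> \<mu>" "\<rho> \<le> \<nu>"
    and "\<And>\<sigma>. \<sigma> \<in> P \<Longrightarrow> \<sigma> \<le> \<mu> \<Longrightarrow> \<sigma> \<le> \<nu> \<Longrightarrow> \<sigma> \<le> \<rho>"
  shows "meet_in P \<mu> \<nu> = \<rho>"
  unfolding meet_in_def using assms by (intro Greatest_equality) auto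

locale meet_tree =
  fixes P :: "'b :: order set"
  assumes chain: "\<lbrakk>\<mu> \<in> P; \<nu> \<in> P; \<eta> \<in> P; \<mu> \<le> \<eta>; \<nu> \<le> \<eta>\<rbrakk> \<Longrightarrow> \<mu> \<le> \<nu> \<or> \<nu> \<le> \<mu>"
    and meet_ex: "\<lbrakk>\<mu> \<in> P; \<nu> \<in> P\<rbrakk> \<Longrightarrow>
      \<exists>\<rho>\<in>P. \<rho> \<le> \<mu> \<and> \<rho> \<le> \<nu> \<and> (\<forall>\<sigma>\<in>P. \<sigma> \<le> \<mu> \<longrightarrow> \<sigma> \<le> \<nu> \<longrightarrow> \<sigma> \<le> \<rho>)"
begin

lemma meet_in_props:
  assumes "\<mu> \<in> P" "\<nu> \<in> P"
  shows meet_in_closed: "meet_in P \<mu> \<nu> \<in> P"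
    and meet_in_le1: "meet_in P \<mu> \<nu> \<le> \<mu>"
    and meet_in_le2: "meet_in P \<mu> \<nu> \<le> \<nu>"
    and meet_in_greatest: "\<lbrakk>\<sigma> \<in> P; \<sigma> \<le> \<mu>; \<sigma> \<le> \<nu>\<rbrakk> \<Longrightarrow> \<sigma> \<le> meet_in P \<mu> \<nu>"
proof -
  obtain \<rho> where \<rho>: "\<rho> \<in> P" "\<rho> \<le> \<mu>" "\<rho> \<le> \<nu>"
    and gr: "\<And>\<sigma>. \<sigma> \<in> P \<Longrightarrow> \<sigma> \<le> \<mu> \<Longrightarrow> \<sigma> \<le> \<nu> \<Longrightarrow> \<sigma> \<le> \<rho>"
    using meet_ex[OF assms] by blast
  have "meet_in P \<mu> \<nu> = \<rho>"
    using \<rho> gr by (rule meet_in_eqI)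
  with \<rho> gr show "meet_in P \<mu> \<nu> \<in> P" "meet_in P \<mu> \<nu> \<le> \<mu>" "meet_in P \<mu> \<nu> \<le> \<nu>"
    and "\<lbrakk>\<sigma> \<in> P; \<sigma> \<le> \<mu>; \<sigma> \<le> \<nu>\<rbrakk> \<Longrightarrow> \<sigma> \<le> meet_in P \<mu> \<nu>"
    by simp_all
qed

lemma topspace_weak_tree: "topspace (weak_tree_topology P) = P"
  by (auto simp: weak_tree_topology_def quotient_def tree_rel_def)

lemma openin_weak_tree_class:
  assumes "\<mu> \<in> P" "\<nu> \<in> P" "\<nu> \<noteq> \<mu>"
  shows "openin (weak_tree_topology P) (tree_rel P \<mu> `` {\<nu>})"
  unfolding weak_tree_topology_def
  by (rule topology_generated_by_Basis) (use assms in \<open>auto simp: quotient_def\<close>)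

lemma self_in_class:
  assumes "\<mu> \<in> P" "\<nu> \<in> P" "\<nu> \<noteq> \<mu>"
  shows "\<nu> \<in> tree_rel P \<mu> `` {\<nu>}"
proof -
  have "meet_in P \<nu> \<nu> = \<nu>"
    using assms by (intro meet_in_eqI) auto
  then show ?thesis
    using assms by (auto simp: tree_rel_def tree_interval_def)
qed

text \<open>The meet of \<nu> and \<xi> lies below \<nu>, as \<mu> does, so it is comparable with
  \<mu>. Were it at most \<mu>, then \<mu> would lie on the interval from \<nu> to \<xi>.\<close>

lemma class_meet_not_le:
  assumes "\<mu> \<in> P" "\<nu> \<in> P" "\<mu> < \<nu>" "\<xi> \<in> tree_rel P \<mu> `` {\<nu>}"
  shows "\<xi> \<in> P" and "\<mu> < meet_in P \<nu> \<xi>"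
proof -
  show \<xi>: "\<xi> \<in> P"
    using assms(4) by (auto simp: tree_rel_def)
  have "\<not> meet_in P \<nu> \<xi> \<le> \<mu>"
    using assms by (auto simp: tree_rel_def tree_interval_def)
  then show "\<mu> < meet_in P \<nu> \<xi>"
    using chain[OF assms(1) meet_in_closed[OF assms(2) \<xi>] assms(2)] meet_in_le1[OF assms(2) \<xi>] assms(3)
    by (auto simp: order.order_iff_strict)
qed

lemma scott_open_nhd:
  assumes U: "scott_open P U" and \<eta>: "\<eta> \<in> U"
  shows "\<exists>W. openin (weak_tree_topology P) W \<and> \<eta> \<in> W \<and> W \<subseteq> U"
proof -
  have UP: "U \<subseteq> P" and \<eta>P: "\<eta> \<in> P"
    using scott_open_subset[OF U] \<eta> by auto
  define D where "D = {\<rho> \<in> P. \<rho> < \<eta>}"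
  show ?thesis
  proof (cases "D = {}")
    case True
    \<comment> \<open>The meet of \<eta> and \<xi> cannot be strictly below \<eta>, so it is
      \<eta>.\<close>
    have "\<eta> \<le> \<xi>" if "\<xi> \<in> P" for \<xi>
      using meet_in_props[OF \<eta>P that] True by (auto simp: D_def order.order_iff_strict)
    then have "P \<subseteq> U"
      using scott_open_upper[OF U \<eta>] by blast
    moreover have "openin (weak_tree_topology P) P"
      using openin_topspace[of "weak_tree_topology P"] topspace_weak_tree by simp
    ultimately show ?thesis
      using \<eta>P by blast
  next
    case nonempty: False
    have "directed_in P D"
      unfolding directed_in_def
    proof (intro conjI ballI)
      show "\<exists>c\<in>D. a \<le> c \<and> b \<le> c" if "a \<in> D" "b \<in> D" for a b
        using that chain[of a b \<eta>] \<eta>P by (auto simp: D_def intro: less_imp_le)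
    qed (use nonempty in \<open>auto simp: D_def\<close>)
    show ?thesis
    proof (cases "is_sup_in P D \<eta>")
      case True
      obtain \<rho> where \<rho>: "\<rho> \<in> D" "\<rho> \<in> U"
        using scott_open_meets[OF U \<open>directed_in P D\<close> True \<eta>] .
      then have \<rho>P: "\<rho> \<in> P" "\<rho> < \<eta>"
        by (auto simp: D_def)
      have "\<xi> \<in> U" if "\<xi> \<in> tree_rel P \<rho> `` {\<eta>}" for \<xi>
      proof -
        note \<xi> = class_meet_not_le[OF \<rho>P(1) \<eta>P \<rho>P(2) that]
        then have "\<rho> \<le> \<xi>"
          using meet_in_le2[OF \<eta>P \<xi>(1)] by auto
        then show ?thesis
          using scott_open_upper[OF U \<rho>(2) \<xi>(1)] by simp
      qed
      then show ?thesis
        using openin_weak_tree_class[OF \<rho>P(1) \<eta>P] self_in_class[OF \<rho>P(1) \<eta>P] \<rho>P(2) by blast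
    next
      case False
      then obtain u where u: "u \<in> P" "\<And>d. d \<in> D \<Longrightarrow> d \<le> u" "\<not> \<eta> \<le> u"
        using \<eta>P by (auto simp: is_sup_in_def D_def)
      \<comment> \<open>Since \<open>u\<close> bounds \<open>D\<close> but is not above \<eta>, this
        meet lies in \<open>D\<close> and bounds \<open>D\<close>: it is the immediate predecessor
        of \<eta>.\<close>
      define \<rho> where "\<rho> = meet_in P \<eta> u"
      note m = meet_in_props[OF \<eta>P u(1), folded \<rho>_def]
      have \<rho>\<eta>: "\<rho> < \<eta>"
        using m(2,3) u(3) by (auto simp: order.order_iff_strict)
      have top: "d \<le> \<rho>" if "d \<in> D" for d
        using m(4) u(2) that by (auto simp: D_def)
      have "\<xi> \<in> U" if "\<xi> \<in> tree_rel P \<rho> `` {\<eta>}" for \<xi>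
      proof -
        note \<xi> = class_meet_not_le[OF m(1) \<eta>P \<rho>\<eta> that]
        note m' = meet_in_props[OF \<eta>P \<xi>(1)]
        have "meet_in P \<eta> \<xi> = \<eta>"
        proof (rule ccontr)
          assume "meet_in P \<eta> \<xi> \<noteq> \<eta>"
          then have "meet_in P \<eta> \<xi> \<in> D"
            using m'(1,2) by (simp add: D_def)
          then show False
            using top \<xi>(2) by (auto simp: leD)
        qed
        then have "\<eta> \<le> \<xi>"
          using m'(3) by simp
        then show ?thesis
          using scott_open_upper[OF U \<eta> \<xi>(1)] by simp
      qed
      then show ?thesis
        using openin_weak_tree_class[OF m(1) \<eta>P] self_in_class[OF m(1) \<eta>P] \<rho>\<eta> by blast
    qed
  qed
qed

lemma scott_strictly_coarser_weak_tree:
  assumes ab: "a \<in> P" "b \<in> P" "a < b"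
  shows "strictly_coarser (scott_topology P) (weak_tree_topology P)"
  unfolding strictly_coarser_def openin_scott_topology
proof (intro conjI psubsetI subsetI)
  have "scott_open P P"
    by (rule scott_openI) (auto simp: directed_in_def)
  then show "topspace (scott_topology P) = topspace (weak_tree_topology P)"
    unfolding topspace_weak_tree
    by (auto simp: topspace_def openin_scott_topology dest: scott_open_subset)
  show "U \<in> {U. openin (weak_tree_topology P) U}" if "U \<in> {U. scott_open P U}" for U
    using scott_open_nhd that by (subst mem_Collect_eq, subst openin_subopen) auto
  have "a \<noteq> b" using ab(3) by simp
  note U = openin_weak_tree_class[OF ab(2,1) this] self_in_class[OF ab(2,1) this]
  have "b \<notin> tree_rel P b `` {a}"
    by (auto simp: tree_rel_def)
  then have "\<not> scott_open P (tree_rel P b `` {a})"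
    using scott_open_upper[OF _ U(2) ab(2) less_imp_le[OF ab(3)]] by blast
  then show "{U. scott_open P U} \<noteq> {U. openin (weak_tree_topology P) U}"
    using U(1) by blast
qed

end


section \<open>Key polynomials and augmented valuations\<close>

lemma infty_ext_add_PInf [simp]: "PInf + x = PInf" "x + PInf = PInf"
  by (auto simp: plus_infty_ext_def split: infty_ext.splits)

lemma infty_ext_Fin_add [simp]: "Fin a + Fin b = Fin (a + b)"
  by (simp add: plus_infty_ext_def)

lemma infty_ext_le_PInf [simp]: "(x :: 'a :: linorder infty_ext) \<le> PInf"
  by (simp add: less_eq_infty_ext_def)

lemma infty_ext_order_simps [simp]:
  fixes a b :: "'a :: linorder"
  shows "(Fin a \<le> Fin b) = (a \<le> b)" "(Fin a < Fin b) = (a < b)"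
    "Fin a < PInf" "\<not> PInf \<le> Fin a" "\<not> PInf < x"
  by (auto simp: less_eq_infty_ext_def less_infty_ext_def)

text \<open>Infinity absorbs, so strictness survives only for finite \<open>a\<close>. Here
  \<open>c\<close> is finite because it is below \<open>d\<close>, while \<open>b\<close> and
  \<open>d\<close> may be infinite.\<close>

lemma infty_ext_add_strict_mono:
  fixes a b c d :: "'a :: linordered_ab_group_add infty_ext"
  assumes "a \<le> b" "c < d" "a < PInf"
  shows "a + c < b + d"
  using assms by (cases a; cases b; cases c; cases d) (auto simp: add_le_less_mono)

lemma infty_ext_min_add:
  fixes a b c :: "'a :: linordered_ab_group_add infty_ext"
  shows "min a b + c = min (a + c) (b + c)"
  by (cases "a \<le> b") (auto simp: min_def not_le intro: antisym add_right_mono less_imp_le)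

section \<open>Values of negatives, quotients and remainders\<close>

lemma valuation_mult: "is_valuation \<nu> \<Longrightarrow> \<nu> (f * g) = \<nu> f + \<nu> g"
  and valuation_add: "is_valuation \<nu> \<Longrightarrow> min (\<nu> f) (\<nu> g) \<le> \<nu> (f + g)"
  and valuation_one: "is_valuation \<nu> \<Longrightarrow> \<nu> 1 = 0"
  and valuation_zero: "is_valuation \<nu> \<Longrightarrow> \<nu> 0 = PInf"
  by (simp_all add: is_valuation_def infinity_infty_ext_def)

text \<open>The square of -1 is 1, and a linearly ordered group has no element of order two.\<close>

lemma valuation_minus_one:
  assumes "is_valuation (\<nu> :: 'r :: comm_ring_1 \<Rightarrow> 'l :: linordered_ab_group_add infty_ext)"
  shows "\<nu> (- 1) = 0"
proof -
  have "\<nu> (- 1) + \<nu> (- 1) = 0"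
    using valuation_mult[OF assms, of "- 1" "- 1"] valuation_one[OF assms] by simp
  then show ?thesis
    by (cases "\<nu> (- 1)") (auto simp: zero_infty_ext_def)
qed

lemma valuation_uminus:
  assumes "is_valuation (\<nu> :: 'r :: comm_ring_1 \<Rightarrow> 'l :: linordered_ab_group_add infty_ext)"
  shows "\<nu> (- f) = \<nu> f"
  using valuation_mult[OF assms, of "- 1" f] valuation_minus_one[OF assms] by simp

text \<open>The ultrametric inequality for \<open>f = q * \<phi> + r\<close>, solved here and in the
  next two lemmas for each term in turn. Together they say that the least of the three values is
  attained at least twice.\<close>

lemma valuation_divmod_ge:
  fixes \<nu> :: "'k :: field poly \<Rightarrow> 'l :: linordered_ab_group_add infty_ext"
  assumes "is_valuation \<nu>"
  shows "min (\<nu> (f div \<phi>) + \<nu> \<phi>) (\<nu> (f mod \<phi>)) \<le> \<nu> f"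
  using valuation_add[OF assms, of "f div \<phi> * \<phi>" "f mod \<phi>"] by (simp add: valuation_mult[OF assms])

lemma valuation_mod_ge:
  fixes \<nu> :: "'k :: field poly \<Rightarrow> 'l :: linordered_ab_group_add infty_ext"
  assumes "is_valuation \<nu>"
  shows "min (\<nu> (f div \<phi>) + \<nu> \<phi>) (\<nu> f) \<le> \<nu> (f mod \<phi>)"
proof -
  have "f mod \<phi> = - (f div \<phi> * \<phi>) + f"
    by (metis add.commute diff_conv_add_uminus minus_div_mult_eq_mod)
  then show ?thesis
    using valuation_add[OF assms, of "- (f div \<phi> * \<phi>)" f]
    by (simp add: valuation_mult[OF assms] valuation_uminus[OF assms])
qed

lemma valuation_mult_mod_ge:
  fixes \<nu> :: "'k :: field poly \<Rightarrow> 'l :: linordered_ab_group_add infty_ext"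
  assumes "is_valuation \<nu>"
  shows "min (\<nu> f) (\<nu> (f mod \<phi>)) \<le> \<nu> (f div \<phi>) + \<nu> \<phi>"
proof -
  have "f div \<phi> * \<phi> = f + - (f mod \<phi>)"
    by (simp add: minus_mod_eq_div_mult)
  then show ?thesis
    using valuation_add[OF assms, of f "- (f mod \<phi>)"]
    by (simp add: valuation_mult[OF assms, symmetric] valuation_uminus[OF assms])
qed

text \<open>The degree test \<open>degree \<phi> = 0\<close> only serves termination.\<close>

function augment ::
    "('k :: field poly \<Rightarrow> 'l :: linordered_ab_group_add infty_ext) \<Rightarrow> 'k poly \<Rightarrow> 'k poly \<Rightarrow> 'l infty_ext" where
  "augment \<mu> \<phi> f =
     (if degree \<phi> = 0 \<or> degree f < degree \<phi> then \<mu> f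
      else min (augment \<mu> \<phi> (f div \<phi>) + \<mu> \<phi>) (\<mu> (f mod \<phi>)))"
  by auto
termination
  by (relation "Wellfounded.measure (\<lambda>(\<mu>, \<phi>, f). degree f)") (auto simp: degree_div_less)

declare augment.simps [simp del]

text \<open>Polynomials of degree below that of \<phi> act as coefficients, on which \<mu> and \<nu>
  agree. The order \<mu> \<le> \<nu> is not built in, so that meets of incomparable valuations are
  covered.\<close>

locale key_polynomial =
  fixes \<mu> \<nu> :: "'k :: field poly \<Rightarrow> 'l :: linordered_ab_group_add infty_ext" and \<phi> :: "'k poly"
  assumes val_\<mu>: "is_valuation \<mu>" and val_\<nu>: "is_valuation \<nu>"
    and degree_pos: "0 < degree \<phi>"
    and agree: "degree f < degree \<phi> \<Longrightarrow> \<mu> f = \<nu> f"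
    and less: "\<mu> \<phi> < \<nu> \<phi>"
begin

abbreviation \<rho> where "\<rho> \<equiv> augment \<mu> \<phi>"

lemma degree_mod: "degree (f mod \<phi>) < degree \<phi>"
  using degree_pos degree_mod_less[of \<phi> f] by fastforce

lemma augment_small: "degree f < degree \<phi> \<Longrightarrow> \<rho> f = \<mu> f"
  by (subst augment.simps) simp

lemma augment_zero: "\<rho> 0 = PInf"
  using degree_pos by (simp add: augment_small valuation_zero[OF val_\<mu>])

text \<open>Removes the case distinction: for small \<open>f\<close> the quotient is 0, whose value
  \<open>PInf\<close> drops out of the minimum.\<close>

lemma augment_rec: "\<rho> f = min (\<rho> (f div \<phi>) + \<mu> \<phi>) (\<rho> (f mod \<phi>))"
proof (cases "degree f < degree \<phi>")
  case True
  then show ?thesis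
    by (simp add: div_poly_less mod_poly_less augment_zero min_absorb2)
next
  case False
  then show ?thesis
    using degree_pos by (subst augment.simps) (simp add: augment_small degree_mod)
qed

lemma augment_le_mod: "\<rho> f \<le> \<rho> (f mod \<phi>)"
  by (subst augment_rec) simp

lemma augment_mult_key: "\<rho> (f * \<phi>) = \<rho> f + \<mu> \<phi>"
  using degree_pos by (subst augment_rec) (auto simp: augment_zero min_absorb1)

text \<open>Induction along the \<phi>-adic expansion, one division at a time.\<close>

lemma degree_induct [case_names small step]:
  assumes "\<And>f. degree f < degree \<phi> \<Longrightarrow> Q f"
    and "\<And>f. degree \<phi> \<le> degree f \<Longrightarrow> degree (f div \<phi>) < degree f \<Longrightarrow> Q (f div \<phi>) \<Longrightarrow> Q f"
  shows "Q f"
proof (induction "degree f" arbitrary: f rule: less_induct)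
  case less
  show ?case
  proof (cases "degree f < degree \<phi>")
    case False
    then have "degree (f div \<phi>) < degree f"
      using degree_pos by (intro degree_div_less) auto
    then show ?thesis
      using assms(2) less False by auto
  qed (use assms(1) in auto)
qed

text \<open>The value of a sum is at least the least value of its terms. With \<sigma> taken as
  \<mu> and as \<nu>, this makes \<rho> a common lower bound.\<close>

lemma augment_le:
  assumes "is_valuation \<sigma>" "\<And>f. degree f < degree \<phi> \<Longrightarrow> \<mu> f \<le> \<sigma> f" "\<mu> \<phi> \<le> \<sigma> \<phi>"
  shows "\<rho> f \<le> \<sigma> f"
proof (induction f rule: degree_induct)
  case (small f)
  then show ?case using assms(2) by (simp add: augment_small)
next
  case (step f)
  have "\<rho> f = min (\<rho> (f div \<phi>) + \<mu> \<phi>) (\<mu> (f mod \<phi>))"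
    by (subst augment_rec) (simp add: augment_small degree_mod)
  also have "\<dots> \<le> min (\<sigma> (f div \<phi>) + \<sigma> \<phi>) (\<sigma> (f mod \<phi>))"
    using step assms(2)[OF degree_mod] assms(3) by (intro min.mono add_mono) auto
  also have "\<dots> \<le> \<sigma> f"
    by (rule valuation_divmod_ge[OF assms(1)])
  finally show ?case .
qed

text \<open>
  If the minimum were not attained, both terms would have the same \<open>\<mu>\<close>-value. Passing to \<open>\<nu>\<close>
  raises the value of the multiple of \<open>\<phi>\<close>, but not that of the remainder.
\<close>

lemma divmod_eq:
  assumes "\<mu> f \<le> \<nu> f" "\<mu> (f div \<phi>) \<le> \<nu> (f div \<phi>)"
  shows "\<mu> f = min (\<mu> (f div \<phi>) + \<mu> \<phi>) (\<mu> (f mod \<phi>))"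
proof (rule ccontr)
  assume neq: "\<not> ?thesis"
  with valuation_divmod_ge[OF val_\<mu>, of f \<phi>]
  have lt: "min (\<mu> (f div \<phi>) + \<mu> \<phi>) (\<mu> (f mod \<phi>)) < \<mu> f"
    by (simp add: order.order_iff_strict eq_commute)
  \<comment> \<open>The least of the three values is attained twice and \<open>\<mu> f\<close> lies
    above it, so the other two values coincide.\<close>
  then have eq: "\<mu> (f div \<phi>) + \<mu> \<phi> = \<mu> (f mod \<phi>)"
    using valuation_mod_ge[OF val_\<mu>, of f \<phi>] valuation_mult_mod_ge[OF val_\<mu>, of f \<phi>]
    by (auto simp: min_def split: if_splits)
  have "\<mu> (f div \<phi>) < PInf"
    using lt eq by (cases "\<mu> (f div \<phi>)") auto
  then have "\<mu> (f mod \<phi>) < \<nu> (f div \<phi>) + \<nu> \<phi>"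
    using infty_ext_add_strict_mono[OF assms(2) less] eq by simp
  moreover have "\<mu> (f mod \<phi>) < \<nu> f"
    using lt eq assms(1) by simp
  ultimately show False
    using valuation_mod_ge[OF val_\<nu>, of f \<phi>] agree[OF degree_mod, of f]
    by (auto simp: min_def split: if_splits)
qed

text \<open>Under \<mu> \<le> \<nu>, \<open>divmod_eq\<close> applies at every step of the
  expansion. With \<open>augment_le\<close> for \<mu> itself this gives \<mu> = \<rho>.\<close>

lemma le_augment:
  assumes "\<mu> \<le> \<nu>"
  shows "\<mu> f \<le> \<rho> f"
proof (induction f rule: degree_induct)
  case (step f)
  have "\<mu> f = min (\<mu> (f div \<phi>) + \<mu> \<phi>) (\<mu> (f mod \<phi>))"
    using assms by (intro divmod_eq) (auto simp: le_fun_def)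
  also have "\<dots> \<le> min (\<rho> (f div \<phi>) + \<mu> \<phi>) (\<rho> (f mod \<phi>))"
    using step by (intro min.mono add_mono) (auto simp: augment_small degree_mod)
  also have "\<dots> = \<rho> f"
    by (rule augment_rec[symmetric])
  finally show ?case .
qed (simp add: augment_small)

text \<open>Through \<mu> \<le> \<rho> \<le> \<sigma>, a comparison of valuations needs testing only
  on \<phi> and in smaller degrees.\<close>

lemma le_criterion:
  assumes "\<mu> \<le> \<nu>" "is_valuation \<sigma>"
    "\<And>f. degree f < degree \<phi> \<Longrightarrow> \<mu> f \<le> \<sigma> f" "\<mu> \<phi> \<le> \<sigma> \<phi>"
  shows "\<mu> \<le> \<sigma>"
  using le_augment[OF assms(1)] augment_le[OF assms(2-4)] by (auto simp: le_fun_def intro: order_trans)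

section \<open>The augmented map is a valuation\<close>

lemma small_mult:
  assumes "degree a < degree \<phi>" "degree b < degree \<phi>"
  shows small_mult_augment: "\<rho> (a * b) = \<mu> a + \<mu> b"
    and small_mult_mod: "\<mu> ((a * b) mod \<phi>) = \<mu> a + \<mu> b"
proof -
  let ?q = "(a * b) div \<phi>" and ?r = "(a * b) mod \<phi>"
  have degq: "degree ?q < degree \<phi>"
  proof (cases "?q = 0")
    case False
    have "\<phi> \<noteq> 0"
      using degree_pos by auto
    then have "degree ?q + degree \<phi> = degree (a * b - ?r)"
      using False by (simp add: minus_mod_eq_div_mult degree_mult_eq)
    also have "\<dots> < degree \<phi> + degree \<phi>"
      using degree_mult_le[of a b] assms degree_mod[of "a * b"] by (intro degree_diff_less) auto
    finally show ?thesis by simp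
  qed (use degree_pos in simp)
  have ab: "\<mu> (a * b) = \<nu> (a * b)"
    using assms by (simp add: valuation_mult[OF val_\<mu>] valuation_mult[OF val_\<nu>] agree)
  have eq: "\<mu> (a * b) = min (\<mu> ?q + \<mu> \<phi>) (\<mu> ?r)"
    using ab agree[OF degq] by (intro divmod_eq) auto
  \<comment> \<open>Quotient and remainder are both small, so in
    \<open>a * b = q * \<phi> + r\<close> passing from \<mu> to \<nu> raises only the value of the
    term \<open>q * \<phi>\<close>. Were that term alone of least value, the value of
    \<open>a * b\<close> would rise too.\<close>
  have "\<mu> ?r \<le> \<mu> ?q + \<mu> \<phi>"
  proof (rule ccontr)
    assume *: "\<not> \<mu> ?r \<le> \<mu> ?q + \<mu> \<phi>"
    then have "\<mu> ?q < PInf"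
      by (cases "\<mu> ?q") auto
    then have "\<mu> ?q + \<mu> \<phi> < \<nu> ?q + \<nu> \<phi>"
      using agree[OF degq] by (intro infty_ext_add_strict_mono less) auto
    moreover have "\<mu> ?q + \<mu> \<phi> < \<nu> ?r"
      using * agree[OF degree_mod, of "a * b"] by simp
    ultimately have "\<mu> ?q + \<mu> \<phi> < \<nu> (a * b)"
      using valuation_divmod_ge[OF val_\<nu>, of "a * b" \<phi>] by (auto simp: min_def split: if_splits)
    then show False
      using eq ab * by auto
  qed
  then show "\<mu> ?r = \<mu> a + \<mu> b"
    using eq by (simp add: valuation_mult[OF val_\<mu>])
  show "\<rho> (a * b) = \<mu> a + \<mu> b"
    using eq by (subst augment_rec) (simp add: augment_small degree_mod degq valuation_mult[OF val_\<mu>])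
qed

text \<open>Quotients and remainders by \<phi> are additive, so expansions add termwise. Both
  polynomials are divided at once, hence the induction on the larger degree.\<close>

lemma augment_add: "min (\<rho> f) (\<rho> g) \<le> \<rho> (f + g)"
proof (induction "max (degree f) (degree g)" arbitrary: f g rule: less_induct)
  case less
  show ?case
  proof (cases "max (degree f) (degree g) < degree \<phi>")
    case True
    then have "degree (f + g) < degree \<phi>"
      by (simp add: degree_add_less)
    then show ?thesis
      using True valuation_add[OF val_\<mu>] by (simp add: augment_small)
  next
    case False
    have q: "min (\<rho> (f div \<phi>)) (\<rho> (g div \<phi>)) \<le> \<rho> (f div \<phi> + g div \<phi>)"
    proof (rule less.hyps)
      \<comment> \<open>The degree of a constant \<open>h\<close> cannot drop, but the maximum is at
        least the positive degree of \<phi>.\<close>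
      have "degree (h div \<phi>) < max (degree f) (degree g)" if "degree h \<le> max (degree f) (degree g)" for h
        using degree_div_less[of h \<phi>] that False degree_pos
        by (cases "degree h = 0") (auto simp: div_poly_less)
      then show "max (degree (f div \<phi>)) (degree (g div \<phi>)) < max (degree f) (degree g)"
        by simp
    qed
    have r: "min (\<rho> (f mod \<phi>)) (\<rho> (g mod \<phi>)) \<le> \<rho> (f mod \<phi> + g mod \<phi>)"
      using valuation_add[OF val_\<mu>] by (simp add: augment_small degree_mod degree_add_less)
    have "min (\<rho> f) (\<rho> g) =
        min (min (\<rho> (f div \<phi>)) (\<rho> (g div \<phi>)) + \<mu> \<phi>) (min (\<rho> (f mod \<phi>)) (\<rho> (g mod \<phi>)))"
      unfolding augment_rec[of f] augment_rec[of g]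
      by (simp add: infty_ext_min_add min.assoc min.left_commute)
    also have "\<dots> \<le> min (\<rho> (f div \<phi> + g div \<phi>) + \<mu> \<phi>) (\<rho> (f mod \<phi> + g mod \<phi>))"
      using q r by (intro min.mono add_right_mono)
    also have "\<dots> = \<rho> (f + g)"
      by (subst augment_rec[of "f + g"]) (simp add: poly_div_add_left poly_mod_add_left)
    finally show ?thesis .
  qed
qed

lemma augment_mult_ge_step:
  assumes "\<rho> (f div \<phi>) + \<rho> g \<le> \<rho> (f div \<phi> * g)" "\<rho> (f mod \<phi>) + \<rho> g \<le> \<rho> (f mod \<phi> * g)"
  shows "\<rho> f + \<rho> g \<le> \<rho> (f * g)"
proof -
  have "\<rho> f + \<rho> g = min (\<rho> (f div \<phi>) + \<rho> g + \<mu> \<phi>) (\<rho> (f mod \<phi>) + \<rho> g)"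
    unfolding augment_rec[of f] infty_ext_min_add by (simp only: add_ac)
  also have "\<dots> \<le> min (\<rho> (f div \<phi> * g * \<phi>)) (\<rho> (f mod \<phi> * g))"
    unfolding augment_mult_key using assms by (intro min.mono add_right_mono)
  also have "\<dots> \<le> \<rho> (f div \<phi> * g * \<phi> + f mod \<phi> * g)"
    by (rule augment_add)
  also have "f div \<phi> * g * \<phi> + f mod \<phi> * g = (f div \<phi> * \<phi> + f mod \<phi>) * g"
    unfolding distrib_right by (simp only: mult_ac)
  also have "\<dots> = f * g"
    by simp
  finally show ?thesis .
qed

text \<open>Two inductions along expansions: first in \<open>g\<close> against a small factor,
  starting from \<open>small_mult_augment\<close>, then in \<open>f\<close>.\<close>

lemma augment_mult_ge: "\<rho> f + \<rho> g \<le> \<rho> (f * g)"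
proof -
  have small: "\<rho> h + \<rho> g \<le> \<rho> (h * g)" if h: "degree h < degree \<phi>" for h
  proof (induction g rule: degree_induct)
    case (small g)
    then show ?case
      using h by (simp add: augment_small small_mult_augment)
  next
    case (step g)
    have "\<rho> (g mod \<phi>) + \<rho> h \<le> \<rho> (g mod \<phi> * h)"
      using h by (simp add: augment_small small_mult_augment degree_mod)
    then show ?case
      using augment_mult_ge_step[of g h] step by (simp add: mult_ac add_ac)
  qed
  show ?thesis
    by (induction f rule: degree_induct) (auto intro: small augment_mult_ge_step degree_mod)
qed

text \<open>With quotient \<open>q\<close> and remainder \<open>r\<close> of \<open>f\<close>, the
  value of \<open>f\<close> comes from \<open>q * \<phi>\<close> alone. In
  \<open>q * g * \<phi> = f * g - r * g\<close> the left side has value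
  \<open>\<rho> f + \<rho> g\<close>, and \<open>r * g\<close> has a larger one if that is finite,
  so \<open>f * g\<close> cannot exceed it.\<close>

lemma augment_mult_le_step:
  assumes lt: "\<rho> f < \<rho> (f mod \<phi>)" and eq: "\<rho> (f div \<phi> * g) = \<rho> (f div \<phi>) + \<rho> g"
  shows "\<rho> (f * g) \<le> \<rho> f + \<rho> g"
proof (cases "\<rho> g < PInf")
  case True
  have "f div \<phi> * g * \<phi> = (f div \<phi> * \<phi>) * g"
    by (simp only: mult_ac)
  also have "f div \<phi> * \<phi> = f - f mod \<phi>"
    by (rule minus_mod_eq_div_mult[symmetric])
  also have "\<dots> * g = f * g + (- (f mod \<phi>)) * g"
    by (simp add: left_diff_distrib)
  finally have "min (\<rho> (f * g)) (\<rho> (- (f mod \<phi>) * g)) \<le> \<rho> (f div \<phi> * g * \<phi>)"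
    using augment_add[of "f * g" "- (f mod \<phi>) * g"] by simp
  also have "\<dots> = \<rho> f + \<rho> g"
    using lt augment_rec[of f] eq by (auto simp: augment_mult_key min_def add_ac split: if_splits)
  finally have *: "min (\<rho> (f * g)) (\<rho> (- (f mod \<phi>) * g)) \<le> \<rho> f + \<rho> g" .
  have "\<rho> f + \<rho> g < \<rho> (f mod \<phi>) + \<rho> g"
    using infty_ext_add_strict_mono[OF order_refl lt True] by (simp add: add.commute)
  also have "\<rho> (f mod \<phi>) = \<rho> (- (f mod \<phi>))"
    by (simp add: augment_small degree_mod valuation_uminus[OF val_\<mu>])
  also have "\<dots> + \<rho> g \<le> \<rho> (- (f mod \<phi>) * g)"
    by (rule augment_mult_ge)
  finally show ?thesis
    using * by (auto simp: min_def split: if_splits)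
next
  case False
  then have "\<rho> g = PInf"
    by (cases "\<rho> g") auto
  then show ?thesis by simp
qed

text \<open>For the upper bound, a factor whose remainder exceeds it in value is replaced by its
  quotient, of lower degree. Otherwise both remainders attain the values of the factors, and
  \<open>small_mult_mod\<close> evaluates the remainder of the product.\<close>

lemma augment_mult: "\<rho> (f * g) = \<rho> f + \<rho> g"
proof (induction "degree f + degree g" arbitrary: f g rule: less_induct)
  case less
  have deg: "degree (h div \<phi>) < degree h" if "\<rho> h < \<rho> (h mod \<phi>)" for h
  proof -
    have "\<not> degree h < degree \<phi>"
      using that by (auto simp: mod_poly_less)
    then show ?thesis
      using degree_pos by (intro degree_div_less) auto
  qed
  have "\<rho> (f * g) \<le> \<rho> f + \<rho> g"
  proof (cases "\<rho> f < \<rho> (f mod \<phi>)")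
    case True
    show ?thesis
      by (rule augment_mult_le_step[OF True less.hyps]) (use deg[OF True] in simp)
  next
    case f: False
    show ?thesis
    proof (cases "\<rho> g < \<rho> (g mod \<phi>)")
      case True
      have "\<rho> (g * f) \<le> \<rho> g + \<rho> f"
        by (rule augment_mult_le_step[OF True less.hyps]) (use deg[OF True] in simp)
      then show ?thesis
        by (simp add: mult_ac add_ac)
    next
      case False
      have "\<rho> (f * g) \<le> \<rho> ((f * g) mod \<phi>)"
        by (rule augment_le_mod)
      also have "\<dots> = \<mu> ((f mod \<phi>) * (g mod \<phi>) mod \<phi>)"
        by (simp add: augment_small degree_mod mod_mult_eq)
      also have "\<dots> = \<rho> (f mod \<phi>) + \<rho> (g mod \<phi>)"
        by (simp add: small_mult_mod degree_mod augment_small)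
      also have "\<dots> \<le> \<rho> f + \<rho> g"
        using f False by (intro add_mono) auto
      finally show ?thesis .
    qed
  qed
  then show ?case
    using augment_mult_ge by (intro antisym)
qed

lemma is_valuation_augment: "is_valuation \<rho>"
  unfolding is_valuation_def
  using degree_pos augment_mult augment_add augment_zero valuation_one[OF val_\<mu>]
  by (simp add: augment_small infinity_infty_ext_def)

end


section \<open>The tree of valuations\<close>

lemma key_polynomial_exI:
  fixes \<mu> \<nu> :: "'k :: field poly \<Rightarrow> 'l :: linordered_ab_group_add infty_ext"
  assumes "\<mu> \<in> valuation_tree v" "\<nu> \<in> valuation_tree v" "\<mu> \<noteq> \<nu>"
  obtains \<phi> where "key_polynomial \<mu> \<nu> \<phi>" | \<phi> where "key_polynomial \<nu> \<mu> \<phi>"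
proof -
  define \<phi> where "\<phi> = arg_min degree (\<lambda>f. \<mu> f \<noteq> \<nu> f)"
  obtain f where "\<mu> f \<noteq> \<nu> f"
    using assms(3) by auto
  then have neq: "\<mu> \<phi> \<noteq> \<nu> \<phi>"
    unfolding \<phi>_def by (rule arg_min_natI)
  have agree: "\<mu> f = \<nu> f" if "degree f < degree \<phi>" for f
    using that arg_min_nat_le[of "\<lambda>f. \<mu> f \<noteq> \<nu> f" f degree] unfolding \<phi>_def by fastforce
  have "\<mu> [:a:] = \<nu> [:a:]" for a
    using assms(1,2) by (simp add: valuation_tree_def)
  \<comment> \<open>Both valuations restrict to \<open>v\<close>, so no constant separates
    them.\<close>
  then have "degree \<phi> > 0"
    using neq by (metis degree_eq_zeroE gr0I)
  then have "key_polynomial \<mu> \<nu> \<phi> \<or> key_polynomial \<nu> \<mu> \<phi>"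
    using neq agree assms(1,2) by (auto simp: key_polynomial_def valuation_tree_def neq_iff)
  then show thesis
    using that by blast
qed

lemma key_polynomial_leI:
  assumes "\<mu> \<in> valuation_tree v" "\<nu> \<in> valuation_tree v" "\<mu> \<le> \<nu>" "\<mu> \<noteq> \<nu>"
  obtains \<phi> where "key_polynomial \<mu> \<nu> \<phi>"
proof -
  have "\<not> key_polynomial \<nu> \<mu> \<phi>" for \<phi>
    using key_polynomial.less[of \<nu> \<mu> \<phi>] le_funD[OF assms(3), of \<phi>] by auto
  then show thesis
    using key_polynomial_exI[OF assms(1,2,4)] that by blast
qed

text \<open>Below the smaller key degree, \<mu> and \<nu> both agree with \<eta>; their values at
  that key polynomial decide which one is smaller.\<close>

lemma valuation_tree_chain:
  assumes "\<mu> \<in> valuation_tree v" "\<nu> \<in> valuation_tree v" "\<eta> \<in> valuation_tree v" "\<mu> \<le> \<eta>" "\<nu> \<le> \<eta>"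
  shows "\<mu> \<le> \<nu> \<or> \<nu> \<le> \<mu>"
proof -
  have wlog: "\<mu> \<le> \<nu> \<or> \<nu> \<le> \<mu>"
    if "key_polynomial \<mu> \<eta> \<phi>" "key_polynomial \<nu> \<eta> \<psi>" "degree \<phi> \<le> degree \<psi>"
      "\<mu> \<le> \<eta>" "\<nu> \<le> \<eta>" for \<mu> \<nu> \<phi> \<psi>
  proof -
    interpret M: key_polynomial \<mu> \<eta> \<phi> by fact
    interpret N: key_polynomial \<nu> \<eta> \<psi> by fact
    have agree: "\<mu> f = \<nu> f" if "degree f < degree \<phi>" for f
      using that \<open>degree \<phi> \<le> degree \<psi>\<close> by (simp add: M.agree N.agree)
    show ?thesis
    proof (cases "\<mu> \<phi> \<le> \<nu> \<phi>")
      case True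
      then show ?thesis
        using M.le_criterion[OF \<open>\<mu> \<le> \<eta>\<close> N.val_\<mu>] agree by simp
    next
      case False
      \<comment> \<open>Here \<open>\<nu> \<phi> < \<mu> \<phi> < \<eta> \<phi>\<close>, so \<phi>
        is a key polynomial for \<nu> and \<eta> too.\<close>
      interpret N': key_polynomial \<nu> \<eta> \<phi>
        using False agree M.agree M.less by unfold_locales (auto simp: M.degree_pos N.val_\<mu> M.val_\<nu>)
      show ?thesis
        using N'.le_criterion[OF \<open>\<nu> \<le> \<eta>\<close> M.val_\<mu>] agree False by simp
    qed
  qed
  show ?thesis
  proof (cases "\<mu> = \<eta> \<or> \<nu> = \<eta>")
    case False
    obtain \<phi> where "key_polynomial \<mu> \<eta> \<phi>"
      using key_polynomial_leI[OF assms(1,3,4)] False by blast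
    moreover obtain \<psi> where "key_polynomial \<nu> \<eta> \<psi>"
      using key_polynomial_leI[OF assms(2,3,5)] False by blast
    ultimately show ?thesis
      using wlog[of \<mu> \<phi> \<nu> \<psi>] wlog[of \<nu> \<psi> \<mu> \<phi>] assms(4,5) by (meson nle_le)
  qed (use assms(4,5) in auto)
qed

text \<open>A common lower bound \<sigma> is comparable with \<rho>, both being below \<nu>. If
  \<rho> \<le> \<sigma>, then \<sigma> is squeezed between \<rho> and \<mu>, which agree in small
  degrees; so \<phi> is a key polynomial for \<sigma> and \<nu>, and \<open>le_criterion\<close>
  gives \<sigma> \<le> \<rho>.\<close>

lemma valuation_tree_meet_key:
  assumes \<mu>: "\<mu> \<in> valuation_tree v" and \<nu>: "\<nu> \<in> valuation_tree v" and key: "key_polynomial \<mu> \<nu> \<phi>"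
  shows "\<exists>\<rho>\<in>valuation_tree v. \<rho> \<le> \<mu> \<and> \<rho> \<le> \<nu> \<and>
    (\<forall>\<sigma>\<in>valuation_tree v. \<sigma> \<le> \<mu> \<longrightarrow> \<sigma> \<le> \<nu> \<longrightarrow> \<sigma> \<le> \<rho>)"
proof -
  interpret key_polynomial \<mu> \<nu> \<phi> by fact
  have tree: "\<rho> \<in> valuation_tree v"
    using \<mu> degree_pos by (auto simp: valuation_tree_def is_valuation_augment augment_small)
  have le: "\<rho> \<le> \<mu>" "\<rho> \<le> \<nu>"
    using augment_le[OF val_\<mu>] augment_le[OF val_\<nu>] agree less by (auto simp: le_fun_def)
  have key_value: "\<rho> \<phi> = \<mu> \<phi>"
    using augment_mult_key[of 1] degree_pos
    by (simp add: augment_small valuation_one[OF val_\<mu>])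
  have "\<sigma> \<le> \<rho>" if \<sigma>: "\<sigma> \<in> valuation_tree v" "\<sigma> \<le> \<mu>" "\<sigma> \<le> \<nu>" for \<sigma>
    using valuation_tree_chain[OF \<sigma>(1) tree \<nu> \<sigma>(3) le(2)]
  proof
    assume ge: "\<rho> \<le> \<sigma>"
    have eq: "\<sigma> f = \<mu> f" if "degree f < degree \<phi>" for f
      using that ge \<sigma>(2) augment_small[OF that] by (metis antisym le_funD)
    have \<sigma>\<phi>: "\<sigma> \<phi> \<le> \<mu> \<phi>"
      using \<sigma>(2) by (simp add: le_fun_def)
    interpret S: key_polynomial \<sigma> \<nu> \<phi>
      using \<sigma>(1) \<sigma>\<phi> less eq agree degree_pos val_\<nu>
      by unfold_locales (auto simp: valuation_tree_def)
    show ?thesis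
      using S.le_criterion[OF \<sigma>(3) is_valuation_augment] eq \<sigma>\<phi> key_value
      by (simp add: augment_small)
  qed
  then show ?thesis
    using tree le by blast
qed

lemma valuation_tree_meet:
  assumes "\<mu> \<in> valuation_tree v" "\<nu> \<in> valuation_tree v"
  shows "\<exists>\<rho>\<in>valuation_tree v. \<rho> \<le> \<mu> \<and> \<rho> \<le> \<nu> \<and>
    (\<forall>\<sigma>\<in>valuation_tree v. \<sigma> \<le> \<mu> \<longrightarrow> \<sigma> \<le> \<nu> \<longrightarrow> \<sigma> \<le> \<rho>)"
proof (cases "\<mu> = \<nu>")
  case False
  then show ?thesis
    using key_polynomial_exI[OF assms]
      valuation_tree_meet_key[OF assms] valuation_tree_meet_key[OF assms(2,1)]
    by metis
qed (use assms in auto)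

interpretation valuation_tree: meet_tree "valuation_tree v"
  by unfold_locales (fact valuation_tree_chain, fact valuation_tree_meet)

text \<open>Evaluation is a ring homomorphism fixing constants. These valuations are infinite on
  multiples of \<open>x - a\<close>.\<close>

lemma evaluation_in_valuation_tree:
  assumes "is_valuation v"
  shows "(\<lambda>f. v (poly f a)) \<in> valuation_tree v"
  using assms by (auto simp: valuation_tree_def is_valuation_def)

theorem proposition4p20:
  fixes v :: "'k :: field \<Rightarrow> 'l :: linordered_ab_group_add infty_ext"
    and \<Gamma>\<^sub>Q :: "'l set"
  assumes valued_field: "is_valuation v"
    and contains_hull: "is_divisible_hull (value_group v) \<Gamma>\<^sub>Q"
    and dense: "\<forall>\<gamma> \<delta> :: 'l. \<gamma> < \<delta> \<longrightarrow> (\<exists>\<alpha>. \<gamma> < \<alpha> \<and> \<alpha> < \<delta>)"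
  shows "strictly_coarser (scott_topology (valuation_tree v)) (weak_tree_topology (valuation_tree v))"
proof -
  let ?e = "\<lambda>a f. v (poly f a)"
  have e: "?e a \<in> valuation_tree v" for a
    using valued_field by (rule evaluation_in_valuation_tree)
  have "?e 0 [:0, 1:] = PInf" "?e 1 [:0, 1:] = 0"
    using valuation_zero[OF valued_field] valuation_one[OF valued_field] by simp_all
  then have neq: "?e 0 \<noteq> ?e 1"
    by (metis infty_ext.distinct(1) zero_infty_ext_def)
  obtain \<rho> where \<rho>: "\<rho> \<in> valuation_tree v" "\<rho> \<le> ?e 0" "\<rho> \<le> ?e 1"
    using valuation_tree_meet[OF e e] by blast
  \<comment> \<open>A common lower bound of two distinct elements is strictly below at least one,
    which supplies the comparable pair.\<close>
  then have "\<rho> < ?e 0 \<or> \<rho> < ?e 1"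
    using neq by (metis order.order_iff_strict)
  then show ?thesis
    using valuation_tree.scott_strictly_coarser_weak_tree[OF \<rho>(1) e] by blast
qed

end
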